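(* Let $P(\lambda)=A-\lambda B$, with $A,B\in M_{2n}(\mathbb{C})$ nonsingular, be a symplectic pencil with eigenvalues $\lambda_1,\lambda_1^{-1},\lambda_2,\lambda_2^{-1},\ldots,\lambda_n,\lambda_n^{-1}\in\mathbb{C}$ and let $\mu\in\mathbb{C}\setminus\{0\}$ be given. Let $x_1,x_2\in\mathbb{C}^{2n}$ be eigenvectors of $P(\lambda)$ for $\lambda_1$ and $\lambda_1^{-1}$, respectively, normalized such that $X^TJ_{2n}X=J_2$ for $X=[\,x_1\;x_2\,]\in M_{2n\times2}(\mathbb{C})$, and set $d:=(\mu+\mu^{-1})-(\lambda_1+\lambda_1^{-1})$. Then the matrix pencil $$\hat{P}(\lambda):=\left(A+BXR\begin{bmatrix}\lambda_1^{-1}&0\\0&\lambda_1\end{bmatrix}X^TJ_{2n}^T\right)-\lambda B$$ is again symplectic and has the eigenvalues $\mu,\mu^{-1},\lambda_2,\lambda_2^{-1},\ldots,\lambda_n,\lambda_n^{-1}$ provided that $R=[r_{ij}]\in M_2(\mathbb{C})$ is chosen such that $$d=\lambda_1r_{12}-\lambda_1^{-1}r_{21}\quad\text{and}\quad 0=r_{12}-r_{21}+r_{11}r_{22}-r_{12}r_{21}.$$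
   Context: $M_{m\times n}(\mathbb{C})$ is the set of complex $m\times n$ matrices, $M_n(\mathbb{C})=M_{n\times n}(\mathbb{C})$, and $^T$ is the transpose without conjugation. $J_{2n} = \begin{bmatrix} 0 & I_n \\ -I_n & 0\end{bmatrix}$ and $J_2=\begin{bmatrix}0&1\\-1&0\end{bmatrix}$. A matrix pencil $P(\lambda)=A-\lambda B$ with $A,B\in M_{2n}(\mathbb{C})$ is symplectic if $AJ_{2n}A^T=BJ_{2n}B^T$. A scalar $\nu\in\mathbb{C}$ is an eigenvalue of $P(\lambda)$ with eigenvector $x\neq0$ if $P(\nu)x=0$, i.e. $Ax=\nu Bx$. For nonsingular $B$ the eigenvalues of $P(\lambda)$, counted with multiplicity, are those of $B^{-1}A$ (the roots of $\det(A-\lambda B)$). *)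

theory Defs
  imports
    "HOL-Computational_Algebra.Fundamental_Theorem_Algebra"
    "Jordan_Normal_Form.Char_Poly"
begin

text \<open>\<open>symp_J n\<close> is the matrix $J_{2n}$, of size \<open>2 * n\<close>.\<close>

definition symp_J :: "nat \<Rightarrow> complex mat" where
  "symp_J n = four_block_mat (0\<^sub>m n n) (1\<^sub>m n) (- 1\<^sub>m n) (0\<^sub>m n n)"

lemma symp_J_carrier [simp]: "symp_J n \<in> carrier_mat (2 * n) (2 * n)"
  unfolding symp_J_def by (simp add: mult_2)

lemma symp_J_1: "symp_J 1 = mat_of_rows_list 2 [[0, 1], [- 1, 0]]"
  unfolding symp_J_def mat_of_rows_list_def
  by (rule eq_matI) (auto simp: less_2_cases_iff)

text \<open>In the following definitions the matrices \<open>A\<close> and \<open>B\<close> stand for the pencil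
  $P(\lambda) = A - \lambda B$.\<close>

definition symplectic_pencil :: "nat \<Rightarrow> complex mat \<Rightarrow> complex mat \<Rightarrow> bool" where
  "symplectic_pencil n A B \<longleftrightarrow>
     A \<in> carrier_mat (2 * n) (2 * n) \<and> B \<in> carrier_mat (2 * n) (2 * n) \<and>
     A * symp_J n * transpose_mat A = B * symp_J n * transpose_mat B"

definition pencil_eigenvector ::
    "complex mat \<Rightarrow> complex mat \<Rightarrow> complex vec \<Rightarrow> complex \<Rightarrow> bool" where
  "pencil_eigenvector A B x \<nu> \<longleftrightarrow>
     x \<in> carrier_vec (dim_col A) \<and> x \<noteq> 0\<^sub>v (dim_col A) \<and>
     (A - \<nu> \<cdot>\<^sub>m B) *\<^sub>v x = 0\<^sub>v (dim_row A)"

text \<open>The matrix polynomial $A - \lambda B$ itself, with the polynomial \<open>[:0, 1:]\<close> as $\lambda$.\<close>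

definition pencil_poly_mat :: "complex mat \<Rightarrow> complex mat \<Rightarrow> complex poly mat" where
  "pencil_poly_mat A B = map_mat (\<lambda>a. [:a:]) A - [:0, 1:] \<cdot>\<^sub>m map_mat (\<lambda>b. [:b:]) B"

text \<open>The eigenvalues with multiplicity, for pencils with \<open>det B \<noteq> 0\<close>. The multiset is empty
  if $\det (A - \lambda B)$ is the zero polynomial.\<close>

definition pencil_eigenvalues :: "complex mat \<Rightarrow> complex mat \<Rightarrow> complex multiset" where
  "pencil_eigenvalues A B = proots (det (pencil_poly_mat A B))"

end

theory Submission
  imports Defs
begin

text \<open>Write \<open>D\<close> for the diagonal matrix with entries \<open>\<lambda>\<^sub>1, \<lambda>\<^sub>1\<^sup>-\<^sup>1\<close>, \<open>K\<close> for \<open>R D\<^sup>-\<^sup>1\<close> and \<open>V\<close> for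
  \<open>K X\<^sup>T J\<^sup>T\<close>. The eigenvector equations say \<open>A X = B X D\<close>, and the new pencil is
  \<open>P(\<lambda>) + B X V\<close>. Both claims then reduce to computations with \<open>2 \<times> 2\<close> matrices.

  Spectrum: \<open>P(\<lambda>) X = B X (D - \<lambda> I)\<close>, so the columns of \<open>X\<close> span a deflating subspace, which the
  update \<open>B X V\<close> preserves: it turns the action \<open>D\<close> on that subspace into \<open>D + V X\<close> and leaves
  the action on the quotient as it was. This is the polynomial identity \<open>det P\<^sub>n\<^sub>e\<^sub>w \<cdot> det (D - \<lambda> I) = det P \<cdot> det (D + V X - \<lambda> I)\<close>
  (\<open>det_pencil_update\<close>, a case of \<open>det_update_on_invariant_subspace\<close>), which exchanges the roots
  \<open>\<lambda>\<^sub>1, \<lambda>\<^sub>1\<^sup>-\<^sup>1\<close> for the eigenvalues of \<open>D + V X\<close>. The normalization of \<open>X\<close> gives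
  \<open>V X = - K J\<^sub>2\<close>. The first condition on \<open>R\<close> says that \<open>D - K J\<^sub>2\<close> has trace \<open>\<mu> + \<mu>\<^sup>-\<^sup>1\<close>, and the
  second that its determinant is \<open>1\<close>.

  Symplecticity: since \<open>J\<close> is skew and orthogonal and \<open>A X = B X D\<close>, the cross terms in
  \<open>A\<^sub>n\<^sub>e\<^sub>w J A\<^sub>n\<^sub>e\<^sub>w\<^sup>T\<close> collapse, and the change of the form is
  \<open>B X (K D\<^sup>T - D K\<^sup>T + K J\<^sub>2 K\<^sup>T) (B X)\<^sup>T\<close> (\<open>skew_form_update\<close>). The bracket equals
  \<open>R - R\<^sup>T + R J\<^sub>2 R\<^sup>T = (r\<^sub>1\<^sub>2 - r\<^sub>2\<^sub>1 + det R) J\<^sub>2\<close>, because a skew \<open>2 \<times> 2\<close> matrix is a multiple of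
  \<open>J\<^sub>2\<close>. So the second condition on \<open>R\<close> is used in both parts.\<close>

section \<open>Determinants under a low-rank update\<close>

text \<open>The block matrix with rows \<open>[P, - Y]\<close> and \<open>[V, 1]\<close> is reduced to block triangular form in two
  ways by column operations. Clearing \<open>V\<close> with the block \<open>1\<close> leaves the Schur complement \<open>P + Y V\<close>;
  multiplying by the matrix with rows \<open>[1, X]\<close> and \<open>[0, L]\<close> turns the upper right block into
  \<open>P X - Y L = 0\<close>. As no inverse occurs, the identity is available for polynomial matrices.\<close>

lemma det_update_on_invariant_subspace:
  fixes P :: "'a :: idom mat"
  assumes P: "P \<in> carrier_mat m m" and X: "X \<in> carrier_mat m k" and Y: "Y \<in> carrier_mat m k"
    and V: "V \<in> carrier_mat k m" and L: "L \<in> carrier_mat k k"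
    and PX: "P * X = Y * L"
  shows "det (P + Y * V) * det L = det P * det (L + V * X)"
proof -
  define F where "F = four_block_mat P (- Y) V (1\<^sub>m k)"
  have F: "F \<in> carrier_mat (m + k) (m + k)"
    unfolding F_def using P by auto
  define S where "S = four_block_mat (1\<^sub>m m) (0\<^sub>m m k) (- V) (1\<^sub>m k)"
  have S: "S \<in> carrier_mat (m + k) (m + k)" unfolding S_def by auto
  define T where "T = four_block_mat (1\<^sub>m m) X (0\<^sub>m k m) L"
  have T: "T \<in> carrier_mat (m + k) (m + k)" unfolding T_def using L by auto
  have "F * S = four_block_mat (P * 1\<^sub>m m + (- Y) * (- V)) (P * 0\<^sub>m m k + (- Y) * 1\<^sub>m k)
      (V * 1\<^sub>m m + 1\<^sub>m k * (- V)) (V * 0\<^sub>m m k + 1\<^sub>m k * 1\<^sub>m k)"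
    unfolding F_def S_def by (rule mult_four_block_mat) (use P Y V in auto)
  also have "\<dots> = four_block_mat (P + Y * V) (- Y) (0\<^sub>m k m) (1\<^sub>m k)"
    using P Y V by auto
  finally have "det (F * S) = det (P + Y * V) * det (1\<^sub>m k)"
    using P Y V by (simp add: det_four_block_mat_lower_left_zero[of _ m _ k])
  moreover have "det S = 1"
    unfolding S_def using V by (subst det_four_block_mat_upper_right_zero[of _ m _ k]) auto
  ultimately have detF: "det F = det (P + Y * V)"
    using det_mult[OF F S] by simp
  have "F * T = four_block_mat (P * 1\<^sub>m m + (- Y) * 0\<^sub>m k m) (P * X + (- Y) * L)
      (V * 1\<^sub>m m + 1\<^sub>m k * 0\<^sub>m k m) (V * X + 1\<^sub>m k * L)"
    unfolding F_def T_def by (rule mult_four_block_mat) (use P X Y V L in auto)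
  also have "\<dots> = four_block_mat P (0\<^sub>m m k) V (L + V * X)"
    unfolding PX using P X Y V L by (auto simp: comm_add_mat[of _ k k])
  finally have "det (F * T) = det P * det (L + V * X)"
    using P X V L by (simp add: det_four_block_mat_upper_right_zero[of _ m _ k])
  moreover have "det T = det L"
    unfolding T_def using X L by (subst det_four_block_mat_lower_left_zero[of _ m _ k]) auto
  ultimately show ?thesis
    using det_mult[OF F T] detF by simp
qed

lemma det_2x2:
  fixes M :: "'a :: comm_ring_1 mat"
  assumes M: "M \<in> carrier_mat 2 2"
  shows "det M = M $$ (0,0) * M $$ (1,1) - M $$ (0,1) * M $$ (1,0)"
  using M by (subst laplace_expansion_column[OF M, of 0])
    (auto simp: numeral_2_eq_2 cofactor_def det_single mat_delete_def)

section \<open>Pencils\<close>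

lemma pencil_poly_mat_carrier:
  "A \<in> carrier_mat r c \<Longrightarrow> B \<in> carrier_mat r c \<Longrightarrow> pencil_poly_mat A B \<in> carrier_mat r c"
  by (auto simp: pencil_poly_mat_def)

lemma index_pencil_poly_mat:
  assumes "A \<in> carrier_mat r c" "B \<in> carrier_mat r c" "i < r" "j < c"
  shows "pencil_poly_mat A B $$ (i, j) = [:A $$ (i, j), - B $$ (i, j):]"
  using assms by (auto simp: pencil_poly_mat_def)

lemma const_poly_mat_mult:
  fixes A :: "'a :: comm_ring_1 mat"
  assumes "A \<in> carrier_mat r c" "B \<in> carrier_mat c s"
  shows "map_mat (\<lambda>a. [:a:]) (A * B) = map_mat (\<lambda>a. [:a:]) A * map_mat (\<lambda>a. [:a:]) B"
proof -
  interpret semiring_hom "\<lambda>a :: 'a. [:a:]"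
    by unfold_locales (auto simp: one_pCons)
  show ?thesis by (rule mat_hom_mult[OF assms])
qed

lemma pencil_poly_mat_mult:
  assumes A: "A \<in> carrier_mat m m" and B: "B \<in> carrier_mat m m" and X: "X \<in> carrier_mat m k"
  shows "pencil_poly_mat A B * map_mat (\<lambda>a. [:a:]) X = pencil_poly_mat (A * X) (B * X)"
  using assms unfolding pencil_poly_mat_def
  by (subst minus_mult_distrib_mat[of _ m m _ _ k]) (auto simp: const_poly_mat_mult)

lemma pencil_poly_mat_left_mult:
  assumes Y: "Y \<in> carrier_mat m k" and D: "D \<in> carrier_mat k k" and E: "E \<in> carrier_mat k k"
  shows "map_mat (\<lambda>a. [:a:]) Y * pencil_poly_mat D E = pencil_poly_mat (Y * D) (Y * E)"
  using assms unfolding pencil_poly_mat_def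
  by (subst mult_minus_distrib_mat[of _ m k _ k]) (auto simp: const_poly_mat_mult)

lemma pencil_poly_mat_add:
  assumes "A \<in> carrier_mat r c" "B \<in> carrier_mat r c" "C \<in> carrier_mat r c"
  shows "pencil_poly_mat (A + C) B = pencil_poly_mat A B + map_mat (\<lambda>a. [:a:]) C"
  using assms by (intro eq_matI) (auto simp: pencil_poly_mat_def)

text \<open>Brauer's eigenvalue replacement for pencils: an update whose columns lie in the span of
  those of \<open>B X\<close> changes only the part of the spectrum that belongs to \<open>X\<close>. The left-hand factor
  \<open>det (D - \<lambda> I)\<close> avoids a division of polynomials.\<close>

lemma det_pencil_update:
  assumes A: "A \<in> carrier_mat m m" and B: "B \<in> carrier_mat m m" and X: "X \<in> carrier_mat m k"
    and V: "V \<in> carrier_mat k m" and D: "D \<in> carrier_mat k k"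
    and AX: "A * X = B * X * D"
  shows "det (pencil_poly_mat (A + B * X * V) B) * det (pencil_poly_mat D (1\<^sub>m k)) =
    det (pencil_poly_mat A B) * det (pencil_poly_mat (D + V * X) (1\<^sub>m k))"
proof -
  let ?c = "map_mat (\<lambda>a :: complex. [:a:])"
  have BX: "B * X \<in> carrier_mat m k" using B X by auto
  have "pencil_poly_mat A B * ?c X = pencil_poly_mat (B * X * D) (B * X * 1\<^sub>m k)"
    using AX by (simp add: pencil_poly_mat_mult[OF A B X] right_mult_one_mat[OF BX])
  also have "\<dots> = ?c (B * X) * pencil_poly_mat D (1\<^sub>m k)"
    using BX D by (simp add: pencil_poly_mat_left_mult)
  finally have "det (pencil_poly_mat A B + ?c (B * X) * ?c V) * det (pencil_poly_mat D (1\<^sub>m k)) =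
    det (pencil_poly_mat A B) * det (pencil_poly_mat D (1\<^sub>m k) + ?c V * ?c X)"
    using A B X V D BX
    by (intro det_update_on_invariant_subspace[of _ m _ k]) (auto intro: pencil_poly_mat_carrier)
  moreover have "pencil_poly_mat (A + B * X * V) B = pencil_poly_mat A B + ?c (B * X) * ?c V"
    using A B V BX by (simp add: pencil_poly_mat_add[of _ m m] const_poly_mat_mult[of _ m k])
  moreover have "pencil_poly_mat (D + V * X) (1\<^sub>m k) = pencil_poly_mat D (1\<^sub>m k) + ?c V * ?c X"
    using D V X by (simp add: pencil_poly_mat_add[of _ k k] const_poly_mat_mult[of _ k m])
  ultimately show ?thesis by simp
qed

lemma proots_monic_quadratic:
  fixes a b :: complex
  shows "proots [:a * b, - (a + b), 1:] = {#a, b#}"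
proof -
  have "[:a * b, - (a + b), 1:] = [:- a, 1:] * [:- b, 1:]"
    by (simp add: algebra_simps)
  moreover have "proots ([:- a, 1:] * [:- b, 1:]) = proots [:- a, 1:] + proots [:- b, 1:]"
    by (rule proots_mult) auto
  ultimately show ?thesis by (simp only: proots_linear_factor) simp
qed

lemma det_pencil_2x2:
  assumes M: "M \<in> carrier_mat 2 2"
    and "M $$ (0,0) + M $$ (1,1) = a + b"
    and "M $$ (0,0) * M $$ (1,1) - M $$ (0,1) * M $$ (1,0) = a * b"
  shows "det (pencil_poly_mat M (1\<^sub>m 2)) = [:a * b, - (a + b), 1:]"
proof -
  have "det (pencil_poly_mat M (1\<^sub>m 2)) =
      [:M $$ (0,0) * M $$ (1,1) - M $$ (0,1) * M $$ (1,0), - (M $$ (0,0) + M $$ (1,1)), 1:]"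
    using M by (simp add: det_2x2[OF pencil_poly_mat_carrier] index_pencil_poly_mat algebra_simps)
  then show ?thesis unfolding assms(2,3) .
qed

lemma pencil_eigenvector_eq:
  assumes A: "A \<in> carrier_mat m m" and B: "B \<in> carrier_mat m m"
    and eigv: "pencil_eigenvector A B x \<nu>"
  shows "A *\<^sub>v x = \<nu> \<cdot>\<^sub>v (B *\<^sub>v x)"
proof -
  have x: "x \<in> carrier_vec m" using eigv A by (auto simp: pencil_eigenvector_def)
  have smult: "(\<nu> \<cdot>\<^sub>m B) *\<^sub>v x = \<nu> \<cdot>\<^sub>v (B *\<^sub>v x)"
    using B x by (intro eq_vecI) auto
  have "A *\<^sub>v x - (\<nu> \<cdot>\<^sub>m B) *\<^sub>v x = (A - \<nu> \<cdot>\<^sub>m B) *\<^sub>v x"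
    by (rule minus_mult_distrib_mat_vec[symmetric]) (use A B x in auto)
  also have "\<dots> = 0\<^sub>v m"
    using eigv A by (simp add: pencil_eigenvector_def)
  finally have diff: "A *\<^sub>v x - \<nu> \<cdot>\<^sub>v (B *\<^sub>v x) = 0\<^sub>v m"
    unfolding smult .
  show ?thesis
  proof (rule eq_vecI)
    fix i assume "i < dim_vec (\<nu> \<cdot>\<^sub>v (B *\<^sub>v x))"
    then have i: "i < m" using B by simp
    then have "(A *\<^sub>v x - \<nu> \<cdot>\<^sub>v (B *\<^sub>v x)) $ i = 0"
      unfolding diff by simp
    then show "(A *\<^sub>v x) $ i = (\<nu> \<cdot>\<^sub>v (B *\<^sub>v x)) $ i"
      using i B by (simp del: index_mult_mat_vec)
  qed (use A B in simp)
qed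

lemma pencil_eigenvalue_nonzero:
  assumes A: "A \<in> carrier_mat m m" and B: "B \<in> carrier_mat m m"
    and inv: "invertible_mat A" and eigv: "pencil_eigenvector A B x \<nu>"
  shows "\<nu> \<noteq> 0"
proof
  assume "\<nu> = 0"
  have x: "x \<in> carrier_vec m" "x \<noteq> 0\<^sub>v m"
    using eigv A by (auto simp: pencil_eigenvector_def)
  have Ax: "A *\<^sub>v x = 0\<^sub>v m"
    using pencil_eigenvector_eq[OF A B eigv] \<open>\<nu> = 0\<close> B x by auto
  obtain A' where "inverts_mat A' A" "inverts_mat A A'"
    using inv by (auto simp: invertible_mat_def)
  then have A': "A' \<in> carrier_mat m m" "A' * A = 1\<^sub>m m"
    using A unfolding inverts_mat_def
    by (metis carrier_matD carrier_matI index_mult_mat(2,3) index_one_mat(2,3))+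
  have "x = A' * A *\<^sub>v x" using A' x by simp
  also have "\<dots> = A' *\<^sub>v (A *\<^sub>v x)" using A'(1) A x by (intro assoc_mult_mat_vec) auto
  also have "\<dots> = 0\<^sub>v m" unfolding Ax using A'(1) by (intro eq_vecI) auto
  finally show False using x by simp
qed

section \<open>Symplecticity\<close>

lemma symp_J_transpose: "transpose_mat (symp_J n) = - symp_J n"
  unfolding symp_J_def by (rule eq_matI) auto

lemma symp_J_orthogonal: "transpose_mat (symp_J n) * symp_J n = 1\<^sub>m (2 * n)"
proof -
  have "transpose_mat (symp_J n) =
      four_block_mat (0\<^sub>m n n) (- 1\<^sub>m n) (1\<^sub>m n) (0\<^sub>m n n)"
    unfolding symp_J_def by (rule eq_matI) auto
  also have "\<dots> * symp_J n = four_block_mat (1\<^sub>m n) (0\<^sub>m n n) (- 0\<^sub>m n n) (1\<^sub>m n)"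
    unfolding symp_J_def by (subst mult_four_block_mat[of _ n n _ n _ n _ _ n _ n]) auto
  also have "- 0\<^sub>m n n = (0\<^sub>m n n :: complex mat)" by (rule eq_matI) auto
  finally show ?thesis by (simp add: mult_2)
qed

text \<open>With dimension equations as premises, associativity and transposition of products become
  conditional rewrite rules whose premises the simplifier discharges by itself.\<close>

lemma mult_assoc_dim:
  fixes A :: "'a :: semiring_0 mat"
  assumes "dim_col A = dim_row B" "dim_col B = dim_row C"
  shows "A * B * C = A * (B * C)"
  by (rule assoc_mult_mat[of _ "dim_row A" "dim_row B" _ "dim_row C" _ "dim_col C"])
    (use assms in auto)

lemma transpose_mult_dim:
  fixes A :: "'a :: comm_semiring_0 mat"
  assumes "dim_col A = dim_row B"
  shows "transpose_mat (A * B) = transpose_mat B * transpose_mat A"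
  by (rule transpose_mult[of _ "dim_row A" "dim_row B" _ "dim_col B"])
    (use assms in auto)

text \<open>The matrix \<open>Y\<close> stands for \<open>B X\<close>. From \<open>J\<^sup>T J = 1\<close> one gets \<open>C J = Y K X\<^sup>T\<close>, and with skewness
  \<open>J C\<^sup>T = - X K\<^sup>T Y\<^sup>T\<close>; with \<open>A X = Y D\<close> every term of the expansion that contains \<open>C\<close> is of the
  form \<open>Y M Y\<^sup>T\<close> with \<open>M\<close> of size \<open>k\<close>, and these \<open>M\<close> add up to the left-hand side of \<open>cond\<close>. Thus
  the update is controlled by a small matrix equation.\<close>

lemma skew_form_update:
  fixes A :: "'a :: comm_ring_1 mat"
  assumes A: "A \<in> carrier_mat m m" and J: "J \<in> carrier_mat m m"
    and X: "X \<in> carrier_mat m k" and Y: "Y \<in> carrier_mat m k"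
    and K: "K \<in> carrier_mat k k" and D: "D \<in> carrier_mat k k"
    and skew: "transpose_mat J = - J" and orth: "transpose_mat J * J = 1\<^sub>m m"
    and AX: "A * X = Y * D"
    and cond: "K * transpose_mat D - D * transpose_mat K
      + K * (transpose_mat X * J * X) * transpose_mat K = 0\<^sub>m k k"
    and C: "C = Y * K * (transpose_mat X * transpose_mat J)"
  shows "(A + C) * J * transpose_mat (A + C) = A * J * transpose_mat A"
proof -
  note dims = carrier_matD[OF A] carrier_matD[OF J] carrier_matD[OF X] carrier_matD[OF Y]
    carrier_matD[OF K] carrier_matD[OF D]
  have Cc: "C \<in> carrier_mat m m" unfolding C using X Y J by auto
  have CJ: "C * J = Y * K * transpose_mat X"
    unfolding C using X by (simp add: mult_assoc_dim dims orth)
  have JJ: "J * J = - 1\<^sub>m m"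
  proof -
    have "- (J * J) = 1\<^sub>m m"
      using orth unfolding skew by (simp only: uminus_mult_left_mat dims)
    then have "- (- (J * J)) = - 1\<^sub>m m" by (rule arg_cong)
    then show ?thesis by (simp only: uminus_uminus_mat)
  qed
  have Ct: "transpose_mat C = J * (X * (transpose_mat K * transpose_mat Y))"
    unfolding C by (simp add: transpose_mult_dim mult_assoc_dim dims)
  have JJC: "J * transpose_mat C = (J * J) * (X * (transpose_mat K * transpose_mat Y))"
    unfolding Ct by (rule mult_assoc_dim[symmetric]) (simp_all add: dims)
  have JCt: "J * transpose_mat C = - (X * (transpose_mat K * transpose_mat Y))"
  proof -
    have "- 1\<^sub>m m * (X * (transpose_mat K * transpose_mat Y))
        = - (1\<^sub>m m * (X * (transpose_mat K * transpose_mat Y)))"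
      by (rule uminus_mult_left_mat) (simp add: dims)
    also have "1\<^sub>m m * (X * (transpose_mat K * transpose_mat Y)) =
        X * (transpose_mat K * transpose_mat Y)"
      by (rule left_mult_one_mat[of _ _ m]) (use X K Y in auto)
    finally show ?thesis using JJC unfolding JJ by simp
  qed
  have AJC: "A * J * transpose_mat C = - (Y * (D * transpose_mat K * transpose_mat Y))"
  proof -
    have "A * J * transpose_mat C = - (A * X * (transpose_mat K * transpose_mat Y))"
      using Cc by (simp add: mult_assoc_dim dims JCt)
    then show ?thesis unfolding AX by (simp add: mult_assoc_dim dims)
  qed
  have CJA: "C * J * transpose_mat A = Y * (K * transpose_mat D * transpose_mat Y)"
  proof -
    have "C * J * transpose_mat A = Y * (K * transpose_mat (A * X))"
      unfolding CJ by (simp add: mult_assoc_dim transpose_mult_dim dims)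
    then show ?thesis unfolding AX by (simp add: mult_assoc_dim transpose_mult_dim dims)
  qed
  have CJC: "C * J * transpose_mat C =
      Y * (K * (transpose_mat X * J * X) * transpose_mat K * transpose_mat Y)"
    unfolding CJ unfolding C by (simp add: mult_assoc_dim transpose_mult_dim dims)
  have "(A + C) * J * transpose_mat (A + C) =
      A * J * transpose_mat A + (C * J * transpose_mat A + A * J * transpose_mat C
        + C * J * transpose_mat C)"
  proof -
    have "(A + C) * J * transpose_mat (A + C) =
        (A * J + C * J) * (transpose_mat A + transpose_mat C)"
      using A J Cc by (simp add: add_mult_distrib_mat[of _ m m] transpose_add[of _ m m])
    also have "\<dots> = (A * J * transpose_mat A + A * J * transpose_mat C) +
        (C * J * transpose_mat A + C * J * transpose_mat C)"
    proof -
      have "(P + Q) * (S + T) = P * S + P * T + (Q * S + Q * T)"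
        if "P \<in> carrier_mat m m" "Q \<in> carrier_mat m m" "S \<in> carrier_mat m m"
          "T \<in> carrier_mat m m" for P Q S T :: "'a mat"
        unfolding add_mult_distrib_mat[OF that(1,2) add_carrier_mat[OF that(4), of S]]
        using that by (simp only: mult_add_distrib_mat)
      then show ?thesis using A J Cc by simp
    qed
    also have "\<dots> = A * J * transpose_mat A + (C * J * transpose_mat A + A * J * transpose_mat C
        + C * J * transpose_mat C)"
    proof -
      have reorder: "(P + Q) + (S + T) = P + (S + Q + T)"
        if "P \<in> carrier_mat m m" "Q \<in> carrier_mat m m" "S \<in> carrier_mat m m"
          "T \<in> carrier_mat m m" for P Q S T :: "'a mat"
        using that by (intro eq_matI) (simp_all add: ac_simps)
      show ?thesis by (rule reorder) (use A J Cc in auto)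
    qed
    finally show ?thesis .
  qed
  moreover have "C * J * transpose_mat A + A * J * transpose_mat C + C * J * transpose_mat C
      = 0\<^sub>m m m"
  proof -
    let ?S = "K * transpose_mat D - D * transpose_mat K
      + K * (transpose_mat X * J * X) * transpose_mat K"
    have "Y * (?S * transpose_mat Y) =
        Y * (K * transpose_mat D * transpose_mat Y) - Y * (D * transpose_mat K * transpose_mat Y)
        + Y * (K * (transpose_mat X * J * X) * transpose_mat K * transpose_mat Y)"
    proof -
      have 1: "K * transpose_mat D \<in> carrier_mat k k" "D * transpose_mat K \<in> carrier_mat k k"
        "K * (transpose_mat X * J * X) * transpose_mat K \<in> carrier_mat k k"
        using K D X J by auto
      have 2: "(P - Q + R) * transpose_mat Y =
          P * transpose_mat Y - Q * transpose_mat Y + R * transpose_mat Y"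
        if "P \<in> carrier_mat k k" "Q \<in> carrier_mat k k" "R \<in> carrier_mat k k" for P Q R
        using that Y by (simp add: add_mult_distrib_mat[of _ k k _ _ m] minus_carrier_mat
            minus_mult_distrib_mat[of _ k k _ _ m])
      have 3: "Y * (P - Q + R) = Y * P - Y * Q + Y * R"
        if "P \<in> carrier_mat k m" "Q \<in> carrier_mat k m" "R \<in> carrier_mat k m" for P Q R
        using that Y by (simp add: mult_add_distrib_mat[of _ m k _ m] minus_carrier_mat
            mult_minus_distrib_mat[of _ m k _ m])
      show ?thesis
        unfolding 2[OF 1] using Y by (intro 3) (use 1 in auto)
    qed
    then have "Y * (K * transpose_mat D * transpose_mat Y)
          - Y * (D * transpose_mat K * transpose_mat Y)
        + Y * (K * (transpose_mat X * J * X) * transpose_mat K * transpose_mat Y) = 0\<^sub>m m m"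
      unfolding cond using Y by simp
    moreover have "P + (- Q) = P - Q"
      if "P \<in> carrier_mat m m" "Q \<in> carrier_mat m m" for P Q :: "'a mat"
      by (rule minus_add_uminus_mat[symmetric, OF that])
    moreover have "Y * (K * transpose_mat D * transpose_mat Y) \<in> carrier_mat m m"
      "Y * (D * transpose_mat K * transpose_mat Y) \<in> carrier_mat m m"
      by (rule carrier_matI; simp only: index_mult_mat index_transpose_mat dims)+
    ultimately show ?thesis
      unfolding AJC CJA CJC by simp
  qed
  ultimately show ?thesis using A J by simp
qed

section \<open>Replacing an eigenvalue pair\<close>

lemma index_mult_mat_inner_2:
  assumes "M \<in> carrier_mat r 2" "N \<in> carrier_mat 2 c" "i < r" "j < c"
  shows "(M * N) $$ (i, j) = M $$ (i, 0) * N $$ (0, j) + M $$ (i, 1) * N $$ (1, j)"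
  using assms by (simp add: scalar_prod_def numeral_2_eq_2)

theorem theorem11:
  fixes n :: nat
    and A B X R A_hat :: "complex mat"
    and x1 x2 :: "complex vec"
    and lam :: "nat \<Rightarrow> complex"
    and \<mu> d :: complex
  assumes "n \<ge> 1"
    and "symplectic_pencil n A B"
    and "invertible_mat A"
    and "invertible_mat B"
    and "pencil_eigenvalues A B = (\<Sum>i = 1..n. {# lam i, inverse (lam i) #})"
    and "\<mu> \<noteq> 0"
    and "pencil_eigenvector A B x1 (lam 1)"
    and "pencil_eigenvector A B x2 (inverse (lam 1))"
    and "X = mat_of_cols (2 * n) [x1, x2]"
    and "transpose_mat X * symp_J n * X = symp_J 1"
    and "d = (\<mu> + inverse \<mu>) - (lam 1 + inverse (lam 1))"
    and "R \<in> carrier_mat 2 2"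
    and "d = lam 1 * R $$ (0, 1) - inverse (lam 1) * R $$ (1, 0)"
    and "0 = R $$ (0, 1) - R $$ (1, 0) + R $$ (0, 0) * R $$ (1, 1) - R $$ (0, 1) * R $$ (1, 0)"
    and "A_hat = A + B * X * R * mat_of_rows_list 2 [[inverse (lam 1), 0], [0, lam 1]]
                       * transpose_mat X * transpose_mat (symp_J n)"
  shows "symplectic_pencil n A_hat B \<and>
    pencil_eigenvalues A_hat B = {# \<mu>, inverse \<mu> #} + (\<Sum>i = 2..n. {# lam i, inverse (lam i) #})"
proof -
  define l where "l = lam 1"
  define J where "J = symp_J n"
  define D where "D = mat_of_rows_list 2 [[l, 0], [0, inverse l]]"
  define E where "E = mat_of_rows_list 2 [[inverse l, 0], [0, l]]"
  define K where "K = R * E"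
  define V where "V = K * (transpose_mat X * transpose_mat J)"
  define C where "C = B * X * K * (transpose_mat X * transpose_mat J)"
  have A: "A \<in> carrier_mat (2 * n) (2 * n)" and B: "B \<in> carrier_mat (2 * n) (2 * n)"
    and symp: "A * J * transpose_mat A = B * J * transpose_mat B"
    using assms(2) by (auto simp: symplectic_pencil_def J_def)
  have J: "J \<in> carrier_mat (2 * n) (2 * n)" by (simp add: J_def)
  have R: "R \<in> carrier_mat 2 2" by fact
  have D: "D \<in> carrier_mat 2 2" and E: "E \<in> carrier_mat 2 2"
    by (auto simp: D_def E_def mat_of_rows_list_def)
  have K: "K \<in> carrier_mat 2 2" using R E by (auto simp: K_def)
  have x: "x1 \<in> carrier_vec (2 * n)" "x2 \<in> carrier_vec (2 * n)"
    using assms(7,8) A by (auto simp: pencil_eigenvector_def)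
  have X: "X \<in> carrier_mat (2 * n) 2" unfolding assms(9) by auto
  note dims = carrier_matD[OF A] carrier_matD[OF J] carrier_matD[OF X] carrier_matD[OF B]
    carrier_matD[OF K] carrier_matD[OF D] carrier_matD[OF E] carrier_matD[OF R]
  have eig: "A *\<^sub>v x1 = l \<cdot>\<^sub>v (B *\<^sub>v x1)" "A *\<^sub>v x2 = inverse l \<cdot>\<^sub>v (B *\<^sub>v x2)"
    using pencil_eigenvector_eq[OF A B] assms(7,8) by (simp_all add: l_def)
  \<comment> \<open>Hence \<open>inverse l\<close> is a genuine reciprocal and \<open>E\<close> is the inverse of \<open>D\<close>.\<close>
  have l0: "l \<noteq> 0"
    using pencil_eigenvalue_nonzero[OF A B assms(3,7)] by (simp add: l_def)
  have AX: "A * X = B * X * D"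
  proof (rule eq_matI)
    fix i j assume "i < dim_row (B * X * D)" "j < dim_col (B * X * D)"
    then have i: "i < 2 * n" and j: "j < 2" by (auto simp: dims)
    have c: "col X 0 = x1" "col X 1 = x2" unfolding assms(9) using x by auto
    have AXi: "(A * X) $$ (i, j) = (A *\<^sub>v col X j) $ i" and
      BXi: "\<And>j. j < 2 \<Longrightarrow> (B * X) $$ (i, j) = (B *\<^sub>v col X j) $ i"
      using i j by (auto simp: dims)
    have "(B * X * D) $$ (i, j) = (B * X) $$ (i, 0) * D $$ (0, j) + (B * X) $$ (i, 1) * D $$ (1, j)"
      by (rule index_mult_mat_inner_2[OF _ D i j]) (use B X in auto)
    then show "(A * X) $$ (i, j) = (B * X * D) $$ (i, j)"
      using eig i j c unfolding AXi
      by (auto simp: less_2_cases_iff BXi D_def mat_of_rows_list_def dims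
          simp del: index_mult_mat(1) index_mult_mat_vec)
  qed (auto simp: dims)
  have G: "transpose_mat X * J * X = symp_J 1" using assms(10) by (simp add: J_def)
  have K_ix: "K $$ (i, 0) = R $$ (i, 0) / l" "K $$ (i, 1) = R $$ (i, 1) * l" if "i < 2" for i
    using that unfolding K_def
    by (simp_all add: index_mult_mat_inner_2[OF R E] divide_inverse)
      (simp_all add: E_def mat_of_rows_list_def)
  have symp_J_ix: "symp_J 1 $$ (0, 0) = 0" "symp_J 1 $$ (0, 1) = 1"
    "symp_J 1 $$ (1, 0) = - 1" "symp_J 1 $$ (1, 1) = 0"
    unfolding symp_J_1 by (simp_all add: mat_of_rows_list_def)
  have D_ix: "D $$ (0, 0) = l" "D $$ (0, 1) = 0" "D $$ (1, 0) = 0" "D $$ (1, 1) = inverse l"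
    by (simp_all add: D_def mat_of_rows_list_def)
  have symp_J1: "symp_J 1 \<in> carrier_mat 2 2" using symp_J_carrier[of 1] by simp
  have r_det: "R $$ (0, 1) - R $$ (1, 0) + R $$ (0, 0) * R $$ (1, 1) - R $$ (0, 1) * R $$ (1, 0) = 0"
    and r_tr: "l * R $$ (0, 1) - inverse l * R $$ (1, 0) = \<mu> + inverse \<mu> - (l + inverse l)"
    using assms(11,13,14) by (auto simp: l_def)
  have KJ: "K * symp_J 1 \<in> carrier_mat 2 2" using K symp_J1 by simp
  have KJ_ix: "(K * symp_J 1) $$ (i, 0) = - R $$ (i, 1) * l"
    "(K * symp_J 1) $$ (i, 1) = R $$ (i, 0) / l" if "i < 2" for i
    using that K_ix[OF that]
    by (simp_all add: index_mult_mat_inner_2[OF K symp_J1] symp_J_ix del: One_nat_def)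
  have cancel: "l * (inverse l * z) = z" for z
    using l0 by (simp add: mult.assoc[symmetric])
  \<comment> \<open>The diagonal entries vanish by skewness; the off-diagonal ones are, up to sign, \<open>r_det\<close>.\<close>
  have cond: "K * transpose_mat D - D * transpose_mat K
      + K * (transpose_mat X * J * X) * transpose_mat K = 0\<^sub>m 2 2"
  proof (rule eq_matI)
    have tr: "transpose_mat K \<in> carrier_mat 2 2" "transpose_mat D \<in> carrier_mat 2 2"
      using K D by auto
    have tr_ix: "transpose_mat K $$ (i, j) = K $$ (j, i)" "transpose_mat D $$ (i, j) = D $$ (j, i)"
      if "i < 2" "j < 2" for i j
      using that by (simp_all add: dims)
    fix i j assume "i < dim_row (0\<^sub>m 2 2 :: complex mat)" "j < dim_col (0\<^sub>m 2 2 :: complex mat)"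
    then have ij: "i < 2" "j < 2" by auto
    then have cases: "i = 0 \<and> j = 0 \<or> i = 0 \<and> j = 1 \<or> i = 1 \<and> j = 0 \<or> i = 1 \<and> j = 1"
      by linarith
    have "(K * transpose_mat D - D * transpose_mat K + K * symp_J 1 * transpose_mat K) $$ (i, j)
      = (K * transpose_mat D) $$ (i, j) - (D * transpose_mat K) $$ (i, j)
        + (K * symp_J 1 * transpose_mat K) $$ (i, j)"
      using ij KJ by (simp add: dims del: index_mult_mat(1))
    also have "\<dots> = 0"
      using r_det l0 cases
      unfolding index_mult_mat_inner_2[OF K tr(2) ij] index_mult_mat_inner_2[OF D tr(1) ij]
        index_mult_mat_inner_2[OF KJ tr(1) ij]
      by (elim disjE) (simp_all add: cancel tr_ix K_ix KJ_ix D_ix algebra_simps del: One_nat_def)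
    finally show "(K * transpose_mat D - D * transpose_mat K
      + K * (transpose_mat X * J * X) * transpose_mat K) $$ (i, j) = 0\<^sub>m 2 2 $$ (i, j)"
      unfolding G using ij by simp
  qed (use K D in auto)
  have A_hat: "A_hat = A + C"
  proof -
    have "A_hat = A + B * X * R * E * transpose_mat X * transpose_mat J"
      using assms(15) by (simp only: E_def l_def J_def)
    then show ?thesis
      unfolding C_def K_def by (simp add: mult_assoc_dim dims)
  qed
  have "B * X \<in> carrier_mat (2 * n) 2" using B X by simp
  then have "A_hat * J * transpose_mat A_hat = A * J * transpose_mat A"
    unfolding A_hat using symp_J_transpose symp_J_orthogonal C_def
    by (intro skew_form_update[OF A J X _ K D _ _ AX cond]) (auto simp: J_def)
  moreover have "A_hat \<in> carrier_mat (2 * n) (2 * n)"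
    unfolding A_hat C_def using A B X J K by auto
  ultimately have "symplectic_pencil n A_hat B"
    unfolding symplectic_pencil_def using B symp by (simp add: J_def)
  moreover have "pencil_eigenvalues A_hat B =
    {# \<mu>, inverse \<mu> #} + (\<Sum>i = 2..n. {# lam i, inverse (lam i) #})"
  proof -
    have V: "V \<in> carrier_mat 2 (2 * n)" unfolding V_def using K X J by auto
    have "V * X = - (K * (transpose_mat X * J * X))"
      unfolding V_def symp_J_transpose[of n, folded J_def] by (simp add: mult_assoc_dim dims)
    then have VX: "V * X = - (K * symp_J 1)" unfolding G .
    have M: "D + V * X \<in> carrier_mat 2 2" using D V X by simp
    have M_ix: "(D + V * X) $$ (i, j) = D $$ (i, j) - (K * symp_J 1) $$ (i, j)"
      if "i < 2" "j < 2" for i j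
      unfolding VX using that carrier_matD[OF KJ] dims
      by (simp del: index_mult_mat One_nat_def)
    have detD: "det (pencil_poly_mat D (1\<^sub>m 2)) = [:l * inverse l, - (l + inverse l), 1:]"
      by (rule det_pencil_2x2[OF D]) (simp_all add: D_ix del: One_nat_def)
    have detM: "det (pencil_poly_mat (D + V * X) (1\<^sub>m 2)) =
        [:\<mu> * inverse \<mu>, - (\<mu> + inverse \<mu>), 1:]"
    proof (rule det_pencil_2x2[OF M])
      show "(D + V * X) $$ (0,0) + (D + V * X) $$ (1,1) = \<mu> + inverse \<mu>"
        using r_tr l0 by (simp add: M_ix D_ix KJ_ix field_simps del: One_nat_def)
      have "(D + V * X) $$ (0,0) * (D + V * X) $$ (1,1) - (D + V * X) $$ (0,1) * (D + V * X) $$ (1,0)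
        = 1 + (R $$ (0, 1) - R $$ (1, 0) + R $$ (0, 0) * R $$ (1, 1) - R $$ (0, 1) * R $$ (1, 0))"
        using l0 by (simp add: M_ix D_ix KJ_ix field_simps del: One_nat_def)
      then show "(D + V * X) $$ (0,0) * (D + V * X) $$ (1,1)
          - (D + V * X) $$ (0,1) * (D + V * X) $$ (1,0) = \<mu> * inverse \<mu>"
        unfolding r_det using assms(6) by simp
    qed
    have "A_hat = A + B * X * V"
      unfolding A_hat C_def V_def by (simp add: mult_assoc_dim dims)
    then have prod: "det (pencil_poly_mat A_hat B) * [:l * inverse l, - (l + inverse l), 1:] =
        det (pencil_poly_mat A B) * [:\<mu> * inverse \<mu>, - (\<mu> + inverse \<mu>), 1:]"
      using det_pencil_update[OF A B X V D AX] by (simp only: detD detM)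
    have sum1: "(\<Sum>i = 1..n. {# lam i, inverse (lam i) #}) =
        {# l, inverse l #} + (\<Sum>i = 2..n. {# lam i, inverse (lam i) #})"
      using assms(1) by (simp add: sum.atLeast_Suc_atMost l_def numeral_2_eq_2)
    then have ev: "proots (det (pencil_poly_mat A B)) =
        {# l, inverse l #} + (\<Sum>i = 2..n. {# lam i, inverse (lam i) #})"
      using assms(5) by (simp only: pencil_eigenvalues_def)
    \<comment> \<open>The zero polynomial has the empty multiset of roots, and here the pair of \<open>l\<close> is present.\<close>
    then have nz: "det (pencil_poly_mat A B) \<noteq> 0" by auto
    then have "det (pencil_poly_mat A B) * [:\<mu> * inverse \<mu>, - (\<mu> + inverse \<mu>), 1:] \<noteq> 0"
      by (intro no_zero_divisors) auto
    then have nz_hat: "det (pencil_poly_mat A_hat B) \<noteq> 0"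
      using prod by (metis mult_zero_left)
    have quad: "[:a, b, 1:] \<noteq> 0" for a b :: complex by simp
    have "proots (det (pencil_poly_mat A_hat B)) + {# l, inverse l #} =
        proots (det (pencil_poly_mat A_hat B) * [:l * inverse l, - (l + inverse l), 1:])"
      by (simp only: proots_mult[OF nz_hat quad] proots_monic_quadratic)
    also have "\<dots> =
        {# l, inverse l #} + (\<Sum>i = 2..n. {# lam i, inverse (lam i) #}) + {# \<mu>, inverse \<mu> #}"
      unfolding prod by (simp only: proots_mult[OF nz quad] proots_monic_quadratic ev)
    finally have "proots (det (pencil_poly_mat A_hat B)) + {# l, inverse l #} =
        {# l, inverse l #} + (\<Sum>i = 2..n. {# lam i, inverse (lam i) #}) + {# \<mu>, inverse \<mu> #}" .
    then show ?thesis
      unfolding pencil_eigenvalues_def by (simp add: ac_simps)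
  qed
  ultimately show ?thesis by blast
qed

end
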